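(* For all integers $c\geq 2$ and $d\geq 2$ there is a finite family $\mathcal{F}$ of subsets of $\mathbb{R}^d$ with $TC_\infty(\mathcal{F})=0$ and Carathéodory number $c(\mathcal{F})=c$.
   Context: For a finite family $\mathcal{F}$ of subsets of $X$ and $S\subseteq X$, $\operatorname{conv}_{\mathcal{F}}(S)$ is the intersection of all members of $\mathcal{F}$ containing $S$, and equals $X$ if no member contains $S$. The Carathéodory number $c(\mathcal{F})$ is the smallest integer $c$ such that for every $S\subseteq X$ and every $x\in\operatorname{conv}_{\mathcal{F}}(S)$ there is $S'\subseteq S$ with $|S'|\leq c$ and $x\in\operatorname{conv}_{\mathcal{F}}(S')$ ($c(\mathcal{F})=\infty$ if none exists). The full topological complexity is $TC_\infty(\mathcal{F})=\sup\{\widetilde\beta_i(\bigcap\mathcal{G};\mathbb{Z}_2)\colon \mathcal{G}\subseteq\mathcal{F},\ i\geq 0\}$, where $\widetilde\beta_i(\cdot;\mathbb{Z}_2)$ is the $i$-th reduced Betti number with $\mathbb{Z}_2$ coefficients. *)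

theory Defs
  imports "HOL-Homology.Homology" "HOL-Library.Z2" "HOL-Library.Extended_Nat"
begin

section \<open>Reduced singular homology with coefficients in the field \<^typ>\<open>bit\<close>\<close>

text \<open>The integral chains of \<^theory>\<open>HOL-Homology.Simplices\<close> with \<^typ>\<open>int\<close> replaced by the
  two-element field; the signs in the boundary map disappear in characteristic 2.\<close>

type_synonym 'a chain2 = "((nat \<Rightarrow> real) \<Rightarrow> 'a) \<Rightarrow>\<^sub>0 bit"

definition singular_chain2_set :: "nat \<Rightarrow> 'a topology \<Rightarrow> 'a chain2 set" where
  "singular_chain2_set p X = {c. Poly_Mapping.keys c \<subseteq> singular_simplex_set p X}"

definition chain2_boundary :: "nat \<Rightarrow> 'a chain2 \<Rightarrow> 'a chain2" where
  "chain2_boundary p c =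
     (if p = 0 then 0
      else \<Sum>f\<in>Poly_Mapping.keys c. \<Sum>k\<le>p.
             Poly_Mapping.single (singular_face p k f) (Poly_Mapping.lookup c f))"

definition chain2_augmentation :: "'a chain2 \<Rightarrow> bit" where
  "chain2_augmentation c = (\<Sum>f\<in>Poly_Mapping.keys c. Poly_Mapping.lookup c f)"

text \<open>Cycles of the augmented chain complex: in degree 0 the boundary map is the augmentation.\<close>

definition reduced_cycle2_set :: "nat \<Rightarrow> 'a topology \<Rightarrow> 'a chain2 set" where
  "reduced_cycle2_set p X =
     {c \<in> singular_chain2_set p X.
        if p = 0 then chain2_augmentation c = 0 else chain2_boundary p c = 0}"

definition boundary2_set :: "nat \<Rightarrow> 'a topology \<Rightarrow> 'a chain2 set" where
  "boundary2_set p X = chain2_boundary (Suc p) ` singular_chain2_set (Suc p) X"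

definition reduced_cycle2_group :: "nat \<Rightarrow> 'a topology \<Rightarrow> 'a chain2 monoid" where
  "reduced_cycle2_group p X = \<lparr>carrier = reduced_cycle2_set p X, monoid.mult = (+), one = 0\<rparr>"

definition reduced_homology2_group :: "nat \<Rightarrow> 'a topology \<Rightarrow> 'a chain2 set monoid" where
  "reduced_homology2_group p X = reduced_cycle2_group p X Mod boundary2_set p X"

text \<open>A commutative group of exponent 2, written multiplicatively, is a vector space over the
  two-element field in a unique way. A linear combination of the elements of a finite set \<open>C\<close> is
  the product of a subset of \<open>C\<close>, namely of the elements with coefficient 1.\<close>

definition Z2_independent :: "('g, 'm) monoid_scheme \<Rightarrow> 'g set \<Rightarrow> bool" where
  "Z2_independent G C \<longleftrightarrow> finite C \<and> C \<subseteq> carrier G \<and>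
     (\<forall>D\<subseteq>C. finprod G (\<lambda>x. x) D = \<one>\<^bsub>G\<^esub> \<longrightarrow> D = {})"

definition Z2_dim :: "('g, 'm) monoid_scheme \<Rightarrow> enat" where
  "Z2_dim G = Sup {enat (card C) | C. Z2_independent G C}"

definition reduced_betti2 :: "nat \<Rightarrow> 'a topology \<Rightarrow> enat" where
  "reduced_betti2 i X = Z2_dim (reduced_homology2_group i X)"

section \<open>Set families\<close>

text \<open>The ground set is the whole type. By \<open>\<Inter>{} = UNIV\<close>, the hull of \<open>S\<close> is the ground set if no
  member of the family contains \<open>S\<close>, and the empty subfamily has the ground set as intersection.\<close>

definition TC_infinity :: "'a::topological_space set set \<Rightarrow> enat" where
  "TC_infinity F = Sup {reduced_betti2 i (top_of_set (\<Inter>G)) | G i. G \<subseteq> F}"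

definition family_conv :: "'a set set \<Rightarrow> 'a set \<Rightarrow> 'a set" where
  "family_conv F S = \<Inter>{A \<in> F. S \<subseteq> A}"

text \<open>The infimum of the empty set in \<^typ>\<open>enat\<close> is \<open>\<infinity>\<close>.\<close>

definition caratheodory_number :: "'a set set \<Rightarrow> enat" where
  "caratheodory_number F =
     Inf {enat c | c. \<forall>S. \<forall>x\<in>family_conv F S.
            \<exists>S'\<subseteq>S. finite S' \<and> card S' \<le> c \<and> x \<in> family_conv F S'}"

end

theory Submission
  imports Defs
begin

text \<open>Take \<open>c\<close> distinct lines through the origin in a plane, with a nonzero point \<open>p\<^sub>i\<close> on the
  \<open>i\<close>-th line, and let \<open>A\<^sub>i\<close> be the union of all lines but the \<open>i\<close>-th. Intersections of the
  \<open>A\<^sub>i\<close> are star-shaped about the origin, hence acyclic. No \<open>A\<^sub>i\<close> contains all of the \<open>p\<^sub>j\<close>, so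
  their hull is the whole space, while every \<open>c - 1\<close> of them lie in a common \<open>A\<^sub>i\<close> and so do not
  capture a point off the lines. Conversely, a family of \<open>c\<close> sets has Caratheodory number at most
  \<open>c\<close>: for each member not containing \<open>S\<close> keep one point of \<open>S\<close> outside it.

  Acyclicity over the two-element field is deduced from integral acyclicity as in the universal
  coefficient theorem: if \<open>z\<close> is a cycle modulo 2, then \<open>\<partial>z = 2d\<close> for an integral cycle \<open>d = \<partial>e\<close>, so
  \<open>z - 2e\<close> is an integral cycle congruent to \<open>z\<close>.\<close>

section \<open>Reduced integral cycles\<close>

definition frag_augmentation :: "('a \<Rightarrow>\<^sub>0 int) \<Rightarrow> int" where
  "frag_augmentation c = (\<Sum>f\<in>Poly_Mapping.keys c. Poly_Mapping.lookup c f)"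

lemma frag_extend_const:
  "frag_extend (\<lambda>_. frag_of s) c = frag_cmul (frag_augmentation c) (frag_of s)"
  by (rule poly_mapping_eqI)
    (simp add: frag_extend_def frag_augmentation_def lookup_sum sum_distrib_right)

lemma frag_augmentation_eq_lookup:
  "frag_augmentation c = Poly_Mapping.lookup (frag_extend (\<lambda>_. frag_of ()) c) ()"
  by (simp add: frag_extend_const)

lemma frag_augmentation_0 [simp]: "frag_augmentation 0 = 0"
  by (simp add: frag_augmentation_def)

lemma frag_augmentation_of [simp]: "frag_augmentation (frag_of f) = 1"
  by (simp add: frag_augmentation_def)

lemma frag_augmentation_diff:
  "frag_augmentation (a - b) = frag_augmentation a - frag_augmentation b"
  by (simp add: frag_augmentation_eq_lookup frag_extend_diff lookup_minus)

lemma frag_augmentation_cmul: "frag_augmentation (frag_cmul k a) = k * frag_augmentation a"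
  by (simp add: frag_augmentation_eq_lookup frag_extend_cmul)

lemma frag_augmentation_chain_boundary: "frag_augmentation (chain_boundary (Suc 0) c) = 0"
  using subset_UNIV
proof (induction c rule: frag_induction)
  case (diff a b)
  then show ?case by (simp add: chain_boundary_diff frag_augmentation_diff)
qed (simp_all add: chain_boundary_of frag_augmentation_diff)

lemma chain_map_const:
  "chain_map p (\<lambda>_. a) c
     = frag_cmul (frag_augmentation c) (frag_of (\<lambda>x\<in>standard_simplex p. a))"
  by (simp add: chain_map_def simplex_map_def o_def flip: frag_extend_const)

definition reduced_cycle :: "nat \<Rightarrow> 'a topology \<Rightarrow> 'a chain \<Rightarrow> bool" where
  "reduced_cycle p X c \<longleftrightarrow>
     singular_chain p X c \<and> (if p = 0 then frag_augmentation c = 0 else chain_boundary p c = 0)"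

lemma reduced_cycle_imp_singular_relcycle: "reduced_cycle p X c \<Longrightarrow> singular_relcycle p X {} c"
  by (cases "p = 0") (auto simp: reduced_cycle_def singular_cycle chain_boundary_def)

lemma reduced_cycle_chain_boundary:
  assumes "singular_chain (Suc p) X c"
  shows "reduced_cycle p X (chain_boundary (Suc p) c)"
  using singular_chain_boundary_alt[OF assms] chain_boundary_boundary[OF assms]
  by (simp add: reduced_cycle_def frag_augmentation_chain_boundary)

lemma reduced_cycle_cmul_iff:
  assumes "k \<noteq> 0"
  shows "reduced_cycle p X (frag_cmul k c) \<longleftrightarrow> reduced_cycle p X c"
  using assms
  by (auto simp: reduced_cycle_def singular_chain_def frag_augmentation_cmul chain_boundary_cmul)

lemma homologous_rel_set_in_reduced_homology_group:
  assumes "reduced_cycle p X c"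
  shows "homologous_rel_set p X {} c \<in> carrier (reduced_homology_group (int p) X)"
proof -
  have relcycle: "singular_relcycle p X {} c"
    using assms by (rule reduced_cycle_imp_singular_relcycle)
  then have in_carrier: "homologous_rel_set p X {} c \<in> carrier (homology_group (int p) X)"
    by (simp add: carrier_relative_homology_group)
  show ?thesis
  proof (cases "p = 0")
    case True
    let ?point = "discrete_topology {()}"
    have "hom_induced (int p) X {} ?point {} (\<lambda>x. ()) (homologous_rel_set p X {} c)
        = homologous_rel_set p ?point {} (chain_map p (\<lambda>x. ()) c)"
      using relcycle by (intro hom_induced_chain_map) auto
    also have "chain_map p (\<lambda>x. ()) c = 0"
      using assms True by (simp add: chain_map_const reduced_cycle_def)
    also have "homologous_rel_set p ?point {} 0 = \<one>\<^bsub>homology_group (int p) ?point\<^esub>"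
      by (simp add: homologous_rel_set_eq_relboundary)
    finally show ?thesis
      using in_carrier by (simp add: carrier_reduced_homology_group kernel_def)
  next
    case False
    then show ?thesis
      using in_carrier by (simp add: un_reduced_homology_group)
  qed
qed

lemma reduced_cycle_imp_chain_boundary:
  assumes "trivial_group (reduced_homology_group (int p) X)" and "reduced_cycle p X c"
  obtains d where "singular_chain (Suc p) X d" "chain_boundary (Suc p) d = c"
proof -
  have "homologous_rel_set p X {} c = singular_relboundary_set p X {}"
    using assms(1) homologous_rel_set_in_reduced_homology_group[OF assms(2)]
    by (simp add: trivial_group_def one_reduced_homology_group)
  then show thesis
    using that by (auto simp: homologous_rel_set_eq_relboundary singular_boundary)
qed

section \<open>Reduction modulo 2\<close>

definition reduce2 :: "('a \<Rightarrow>\<^sub>0 int) \<Rightarrow> ('a \<Rightarrow>\<^sub>0 bit)" where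
  "reduce2 = Poly_Mapping.map of_int"

lemma lookup_reduce2 [simp]: "Poly_Mapping.lookup (reduce2 c) f = of_int (Poly_Mapping.lookup c f)"
  by (simp add: reduce2_def map.rep_eq when_def)

lemma reduce2_0 [simp]: "reduce2 0 = 0"
  by (rule poly_mapping_eqI) simp

lemma reduce2_add: "reduce2 (a + b) = reduce2 a + reduce2 b"
  by (rule poly_mapping_eqI) (simp add: lookup_add)

lemma reduce2_diff: "reduce2 (a - b) = reduce2 a - reduce2 b"
  by (rule poly_mapping_eqI) (simp add: lookup_minus del: minus_bit_def)

lemma reduce2_sum: "reduce2 (sum g I) = (\<Sum>i\<in>I. reduce2 (g i))"
  by (induction I rule: infinite_finite_induct) (simp_all add: reduce2_add)

lemma reduce2_cmul_of: "reduce2 (frag_cmul k (frag_of s)) = Poly_Mapping.single s (of_int k)"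
  by (rule poly_mapping_eqI) (simp add: lookup_single when_def)

lemma keys_reduce2: "Poly_Mapping.keys (reduce2 c) \<subseteq> Poly_Mapping.keys c"
  by (auto simp: in_keys_iff)

lemma reduce2_lift:
  obtains a where "reduce2 a = c" "Poly_Mapping.keys a \<subseteq> Poly_Mapping.keys c"
proof
  let ?a = "Poly_Mapping.map (\<lambda>b :: bit. of_bool (b \<noteq> 0) :: int) c"
  show "reduce2 ?a = c"
    by (rule poly_mapping_eqI) (auto simp: map.rep_eq when_def)
  show "Poly_Mapping.keys ?a \<subseteq> Poly_Mapping.keys c"
    by (auto simp: in_keys_iff map.rep_eq when_def split: if_splits)
qed

lemma of_int_bit_eq: "(of_int k :: bit) = of_bool (odd k)"
  by (cases "even k") (auto elim!: evenE oddE)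

lemma reduce2_eq_0_iff: "reduce2 c = 0 \<longleftrightarrow> (\<exists>d. c = frag_cmul 2 d)"
proof
  assume "reduce2 c = 0"
  then have "even (Poly_Mapping.lookup c f)" for f
    using lookup_reduce2[of c f] by (simp add: of_int_bit_eq)
  then have "c = frag_cmul 2 (Poly_Mapping.map (\<lambda>k. k div 2) c)"
    by (intro poly_mapping_eqI) (simp add: map.rep_eq when_def)
  then show "\<exists>d. c = frag_cmul 2 d" ..
next
  assume "\<exists>d. c = frag_cmul 2 d"
  then show "reduce2 c = 0"
    by (auto intro!: poly_mapping_eqI)
qed

lemma reduce2_diff_cmul_2: "reduce2 (a - frag_cmul 2 e) = reduce2 a"
proof -
  have "reduce2 (frag_cmul 2 e) = 0"
    using reduce2_eq_0_iff by blast
  then show ?thesis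
    by (simp add: reduce2_diff)
qed

lemma chain2_augmentation_reduce2:
  "chain2_augmentation (reduce2 c) = of_int (frag_augmentation c)"
proof -
  have "chain2_augmentation (reduce2 c)
      = (\<Sum>f\<in>Poly_Mapping.keys c. of_int (Poly_Mapping.lookup c f))"
    unfolding chain2_augmentation_def lookup_reduce2
    by (intro sum.mono_neutral_left finite_keys keys_reduce2) (auto simp: in_keys_iff)
  then show ?thesis by (simp add: frag_augmentation_def)
qed

lemma chain2_boundary_reduce2: "chain2_boundary p (reduce2 c) = reduce2 (chain_boundary p c)"
proof (cases "p = 0")
  case False
  have signs_vanish: "of_int (l * (-1) ^ k) = (of_int l :: bit)" for l k
    by (simp only: of_int_bit_eq even_mult_iff even_power even_minus odd_one simp_thms)
  have "chain2_boundary p (reduce2 c)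
      = (\<Sum>f\<in>Poly_Mapping.keys c. \<Sum>k\<le>p.
           Poly_Mapping.single (singular_face p k f) (of_int (Poly_Mapping.lookup c f)))"
    unfolding chain2_boundary_def lookup_reduce2 if_not_P[OF False]
    by (intro sum.mono_neutral_left finite_keys keys_reduce2) (auto simp: in_keys_iff)
  also have "\<dots> = reduce2 (chain_boundary p c)"
    using False
    by (simp add: chain_boundary_def frag_extend_def reduce2_sum frag_cmul_sum reduce2_cmul_of
        signs_vanish del: of_int_mult of_int_power)
  finally show ?thesis .
qed (simp add: chain2_boundary_def chain_boundary_def)

lemma singular_chain2_set_eq: "singular_chain2_set p X = reduce2 ` singular_chain_set p X"
proof
  show "singular_chain2_set p X \<subseteq> reduce2 ` singular_chain_set p X"
  proof
    fix c assume "c \<in> singular_chain2_set p X"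
    moreover obtain a where "reduce2 a = c" "Poly_Mapping.keys a \<subseteq> Poly_Mapping.keys c"
      by (rule reduce2_lift)
    ultimately show "c \<in> reduce2 ` singular_chain_set p X"
      by (auto simp: singular_chain_def singular_chain2_set_def)
  qed
  show "reduce2 ` singular_chain_set p X \<subseteq> singular_chain2_set p X"
    using keys_reduce2 by (fastforce simp: singular_chain_def singular_chain2_set_def)
qed

lemma boundary2_set_eq:
  "boundary2_set p X = (\<lambda>a. reduce2 (chain_boundary (Suc p) a)) ` singular_chain_set (Suc p) X"
  by (simp add: boundary2_set_def singular_chain2_set_eq image_image chain2_boundary_reduce2)

lemma reduce2_in_reduced_cycle2_set:
  "reduced_cycle p X a \<Longrightarrow> reduce2 a \<in> reduced_cycle2_set p X"
  by (simp add: reduced_cycle_def reduced_cycle2_set_def singular_chain2_set_eq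
      chain2_augmentation_reduce2 chain2_boundary_reduce2)

lemma boundary2_set_subset_reduced_cycle2_set: "boundary2_set p X \<subseteq> reduced_cycle2_set p X"
  by (auto simp: boundary2_set_eq intro: reduce2_in_reduced_cycle2_set reduced_cycle_chain_boundary)

lemma bit_mapping_add_self: "c + c = (0 :: 'a \<Rightarrow>\<^sub>0 bit)"
proof (rule poly_mapping_eqI)
  show "Poly_Mapping.lookup (c + c) f = Poly_Mapping.lookup 0 f" for f
    by (cases "Poly_Mapping.lookup c f") (simp_all add: lookup_add)
qed

lemma chain2_boundary_add: "chain2_boundary p (a + b) = chain2_boundary p a + chain2_boundary p b"
  by (metis reduce2_lift reduce2_add chain2_boundary_reduce2 chain_boundary_add)

lemma chain2_augmentation_add:
  "chain2_augmentation (a + b) = chain2_augmentation a + chain2_augmentation b"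
proof -
  have sum_over_superset: "chain2_augmentation c = (\<Sum>f\<in>F. Poly_Mapping.lookup c f)"
    if "finite F" "Poly_Mapping.keys c \<subseteq> F" for c :: "'a chain2" and F
    unfolding chain2_augmentation_def
    using that by (intro sum.mono_neutral_left) (auto simp: in_keys_iff)
  show ?thesis
    using sum_over_superset[of "Poly_Mapping.keys a \<union> Poly_Mapping.keys b"]
      Poly_Mapping.keys_add[of a b]
    by (simp add: lookup_add sum.distrib del: add_bit_eq_xor)
qed

lemma comm_group_reduced_cycle2_group: "comm_group (reduced_cycle2_group p X)"
proof (rule comm_groupI)
  let ?Z = "reduced_cycle2_group p X"
  show "a \<otimes>\<^bsub>?Z\<^esub> b \<in> carrier ?Z" if "a \<in> carrier ?Z" "b \<in> carrier ?Z" for a b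
    using that Poly_Mapping.keys_add[of a b]
    by (auto simp: reduced_cycle2_group_def reduced_cycle2_set_def singular_chain2_set_def
        chain2_boundary_add chain2_augmentation_add simp del: add_bit_eq_xor split: if_splits)
  show "\<one>\<^bsub>?Z\<^esub> \<in> carrier ?Z"
    by (simp add: reduced_cycle2_group_def reduced_cycle2_set_def singular_chain2_set_def
        chain2_augmentation_def chain2_boundary_def)
  show "\<exists>b\<in>carrier ?Z. b \<otimes>\<^bsub>?Z\<^esub> a = \<one>\<^bsub>?Z\<^esub>" if "a \<in> carrier ?Z" for a
    using that bit_mapping_add_self by (auto simp: reduced_cycle2_group_def)
qed (simp_all add: reduced_cycle2_group_def add_ac)

section \<open>Universal coefficients\<close>

lemma reduced_cycle2_set_0_lift:
  assumes "c \<in> reduced_cycle2_set 0 X"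
  obtains a where "reduced_cycle 0 X a" "reduce2 a = c"
proof -
  obtain a where chain: "singular_chain 0 X a" and lift: "reduce2 a = c"
    using assms by (auto simp: reduced_cycle2_set_def singular_chain2_set_eq)
  show thesis
  proof (cases "a = 0")
    case True
    then show ?thesis
      using lift that[of 0] by (simp add: reduced_cycle_def)
  next
    case False
    then obtain s where "s \<in> Poly_Mapping.keys a"
      by fastforce
    then have vertex: "singular_chain 0 X (frag_of s)"
      using chain by (auto simp: singular_chain_def)
    have "even (frag_augmentation a)"
      using assms lift
      by (auto simp: reduced_cycle2_set_def chain2_augmentation_reduce2 of_int_bit_eq)
    then obtain k where "frag_augmentation a = 2 * k" ..
    then have "reduced_cycle 0 X (a - frag_cmul 2 (frag_cmul k (frag_of s)))"
      using chain vertex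
      by (simp add: reduced_cycle_def singular_chain_diff singular_chain_cmul
          frag_augmentation_diff frag_augmentation_cmul del: frag_cmul_cmul)
    then show ?thesis
      using that lift reduce2_diff_cmul_2 by metis
  qed
qed

lemma reduced_cycle2_set_Suc_lift:
  assumes acyclic: "trivial_group (reduced_homology_group (int p) X)"
    and cycle: "c \<in> reduced_cycle2_set (Suc p) X"
  obtains a where "reduced_cycle (Suc p) X a" "reduce2 a = c"
proof -
  obtain a where chain: "singular_chain (Suc p) X a" and lift: "reduce2 a = c"
    using cycle by (auto simp: reduced_cycle2_set_def singular_chain2_set_eq)
  then have "reduce2 (chain_boundary (Suc p) a) = 0"
    using cycle by (auto simp: reduced_cycle2_set_def chain2_boundary_reduce2)
  then obtain d where boundary: "chain_boundary (Suc p) a = frag_cmul 2 d"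
    unfolding reduce2_eq_0_iff ..
  have "reduced_cycle p X d"
    using reduced_cycle_chain_boundary[OF chain] by (simp add: boundary reduced_cycle_cmul_iff)
  then obtain e where "singular_chain (Suc p) X e" "chain_boundary (Suc p) e = d"
    using reduced_cycle_imp_chain_boundary[OF acyclic] by blast
  then have "reduced_cycle (Suc p) X (a - frag_cmul 2 e)"
    using chain boundary
    by (simp add: reduced_cycle_def singular_chain_diff singular_chain_cmul chain_boundary_diff
        chain_boundary_cmul)
  then show thesis
    using that lift reduce2_diff_cmul_2 by metis
qed

lemma reduced_cycle2_set_eq_boundary2_set:
  assumes "trivial_group (reduced_homology_group (int p) X)"
    and "trivial_group (reduced_homology_group (int p - 1) X)"
  shows "reduced_cycle2_set p X = boundary2_set p X"
proof
  show "reduced_cycle2_set p X \<subseteq> boundary2_set p X"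
  proof
    fix c assume cycle: "c \<in> reduced_cycle2_set p X"
    obtain a where lift_cycle: "reduced_cycle p X a" and lift: "reduce2 a = c"
    proof (cases p)
      case 0
      then show ?thesis
        using that cycle reduced_cycle2_set_0_lift by blast
    next
      case (Suc q)
      then have "trivial_group (reduced_homology_group (int q) X)"
        using assms(2) by simp
      then show ?thesis
        using cycle that unfolding Suc by (rule reduced_cycle2_set_Suc_lift)
    qed
    obtain d where "singular_chain (Suc p) X d" "chain_boundary (Suc p) d = a"
      using reduced_cycle_imp_chain_boundary[OF assms(1) lift_cycle] .
    then show "c \<in> boundary2_set p X"
      using lift by (auto simp: boundary2_set_eq)
  qed
qed (rule boundary2_set_subset_reduced_cycle2_set)

lemma (in group) trivial_FactGroup_carrier: "trivial_group (G Mod carrier G)"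
proof -
  have "group (G Mod carrier G)"
    by (rule normal.factorgroup_is_group) (simp add: normal_self)
  moreover have "carrier (G Mod carrier G) = {carrier G}"
    by (force simp: carrier_FactGroup coset_join2 subgroup_self)
  ultimately show ?thesis
    by (simp add: trivial_group_def)
qed

lemma Z2_dim_trivial_group:
  fixes G (structure)
  assumes "trivial_group G"
  shows "Z2_dim G = 0"
proof -
  interpret group G
    using assms by (simp add: trivial_group_def)
  have carrier: "carrier G = {\<one>}"
    using assms by (simp add: trivial_group_def)
  interpret comm_group G
    by (rule group_comm_groupI) (simp add: carrier)
  have "C = {}" if "Z2_independent G C" for C
  proof -
    have "C = {} \<or> C = {\<one>}"
      using that carrier by (auto simp: Z2_independent_def)
    moreover have "\<not> Z2_independent G {\<one>}"
      by (auto simp: Z2_independent_def)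
    ultimately show ?thesis
      using that by blast
  qed
  then have "{enat (card C) | C. Z2_independent G C} \<subseteq> {0}"
    by (force simp: zero_enat_def)
  then show ?thesis
    unfolding Z2_dim_def by (intro antisym Sup_least) auto
qed

theorem reduced_betti2_eq_0_trivial_homology:
  assumes "trivial_group (reduced_homology_group (int p) X)"
    and "trivial_group (reduced_homology_group (int p - 1) X)"
  shows "reduced_betti2 p X = 0"
proof -
  interpret comm_group "reduced_cycle2_group p X"
    by (rule comm_group_reduced_cycle2_group)
  have "boundary2_set p X = carrier (reduced_cycle2_group p X)"
    using reduced_cycle2_set_eq_boundary2_set[OF assms] by (simp add: reduced_cycle2_group_def)
  then have "trivial_group (reduced_homology2_group p X)"
    using trivial_FactGroup_carrier by (simp add: reduced_homology2_group_def)
  then show ?thesis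
    unfolding reduced_betti2_def by (rule Z2_dim_trivial_group)
qed

corollary TC_infinity_eq_0_contractible:
  assumes "\<And>G. G \<subseteq> F \<Longrightarrow> contractible (\<Inter>G)"
  shows "TC_infinity F = 0"
proof -
  have "reduced_betti2 i (top_of_set (\<Inter>G)) = 0" if "G \<subseteq> F" for G i
    using assms[OF that]
    by (intro reduced_betti2_eq_0_trivial_homology
        trivial_reduced_homology_group_contractible_space) simp_all
  then show ?thesis
    unfolding TC_infinity_def by (intro antisym Sup_least) auto
qed

lemma TC_infinity_eq_0_common_star_centre:
  fixes F :: "'a::real_normed_vector set set"
  assumes "\<And>A. A \<in> F \<Longrightarrow> z \<in> A"
    and "\<And>A x. A \<in> F \<Longrightarrow> x \<in> A \<Longrightarrow> closed_segment z x \<subseteq> A"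
  shows "TC_infinity F = 0"
proof (rule TC_infinity_eq_0_contractible)
  fix G assume "G \<subseteq> F"
  then have "starlike (\<Inter>G)"
    unfolding starlike_def using assms by (intro bexI[of _ z]) blast+
  then show "contractible (\<Inter>G)"
    by (rule starlike_imp_contractible)
qed

section \<open>Caratheodory numbers\<close>

lemma family_conv_mono: "S \<subseteq> T \<Longrightarrow> family_conv F S \<subseteq> family_conv F T"
  by (auto simp: family_conv_def)

lemma family_conv_eq_finite_subset:
  assumes "finite F"
  obtains S' where "S' \<subseteq> S" "finite S'" "card S' \<le> card F" "family_conv F S' = family_conv F S"
proof -
  let ?N = "{A \<in> F. \<not> S \<subseteq> A}"
  have "\<forall>A\<in>?N. \<exists>s. s \<in> S - A" by blast
  then obtain s where witness: "\<And>A. A \<in> ?N \<Longrightarrow> s A \<in> S - A" by metis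
  have "card (s ` ?N) \<le> card F"
    using assms by (intro order_trans[OF card_image_le card_mono]) auto
  moreover have "{A \<in> F. s ` ?N \<subseteq> A} = {A \<in> F. S \<subseteq> A}"
    using witness by blast
  ultimately show thesis
    using assms witness that[of "s ` ?N"] by (auto simp: family_conv_def)
qed

lemma caratheodory_number_le_card:
  assumes "finite F"
  shows "caratheodory_number F \<le> enat (card F)"
proof -
  have "\<exists>S'\<subseteq>S. finite S' \<and> card S' \<le> card F \<and> x \<in> family_conv F S'"
    if "x \<in> family_conv F S" for S x
    using family_conv_eq_finite_subset[OF assms, of S] that by metis
  then show ?thesis
    unfolding caratheodory_number_def by (intro Inf_lower) blast
qed

lemma card_le_caratheodory_number:
  assumes "x \<in> family_conv F P" and "\<And>q. q \<in> P \<Longrightarrow> x \<notin> family_conv F (P - {q})"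
  shows "enat (card P) \<le> caratheodory_number F"
  unfolding caratheodory_number_def
proof (rule Inf_greatest, safe)
  fix k
  assume "\<forall>S. \<forall>x\<in>family_conv F S. \<exists>S'\<subseteq>S. finite S' \<and> card S' \<le> k \<and> x \<in> family_conv F S'"
  then obtain S' where "S' \<subseteq> P" and card_le: "card S' \<le> k" and in_conv: "x \<in> family_conv F S'"
    using assms(1) by blast
  have "S' = P"
  proof (rule ccontr)
    assume "S' \<noteq> P"
    then obtain q where "q \<in> P" "S' \<subseteq> P - {q}" using \<open>S' \<subseteq> P\<close> by blast
    then show False
      using assms(2) in_conv family_conv_mono by blast
  qed
  then show "enat (card P) \<le> enat k" using card_le by simp
qed

lemma caratheodory_number_eq_card:
  assumes "finite I"
    and mem_iff: "\<And>i j. i \<in> I \<Longrightarrow> j \<in> I \<Longrightarrow> p j \<in> A i \<longleftrightarrow> j \<noteq> i"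
    and outside: "\<And>i. i \<in> I \<Longrightarrow> x \<notin> A i"
  shows "caratheodory_number (A ` I) = enat (card I)"
proof (rule antisym)
  have "caratheodory_number (A ` I) \<le> enat (card (A ` I))"
    using \<open>finite I\<close> by (intro caratheodory_number_le_card) simp
  also have "\<dots> \<le> enat (card I)"
    using \<open>finite I\<close> by (simp add: card_image_le)
  finally show "caratheodory_number (A ` I) \<le> enat (card I)" .
  have "inj_on p I"
    using mem_iff by (metis inj_onI)
  moreover have "enat (card (p ` I)) \<le> caratheodory_number (A ` I)"
  proof (rule card_le_caratheodory_number)
    show "x \<in> family_conv (A ` I) (p ` I)"
      using mem_iff by (auto simp: family_conv_def)
    show "x \<notin> family_conv (A ` I) (p ` I - {q})" if "q \<in> p ` I" for q
    proof -
      obtain i where "i \<in> I" and "q = p i"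
        using \<open>q \<in> p ` I\<close> by blast
      then have "p ` I - {q} \<subseteq> A i"
        using mem_iff by auto
      then show ?thesis
        using outside \<open>i \<in> I\<close> by (auto simp: family_conv_def)
    qed
  qed
  ultimately show "enat (card I) \<le> caratheodory_number (A ` I)"
    by (simp add: card_image)
qed

section \<open>Lines through the origin\<close>

definition other_lines :: "('i \<Rightarrow> 'a::real_vector) \<Rightarrow> 'i set \<Rightarrow> 'i \<Rightarrow> 'a set" where
  "other_lines p I i = (\<Union>j\<in>I - {i}. span {p j})"

lemma TC_infinity_other_lines:
  fixes p :: "'i \<Rightarrow> 'a::real_normed_vector"
  assumes "\<And>i. I \<noteq> {i}"
  shows "TC_infinity (other_lines p I ` I) = 0"
proof (rule TC_infinity_eq_0_common_star_centre)
  fix A assume member: "A \<in> other_lines p I ` I"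
  then show "0 \<in> A"
    using assms by (force simp: other_lines_def span_zero)
  show "closed_segment 0 x \<subseteq> A" if "x \<in> A" for x
  proof -
    obtain j where in_line: "x \<in> span {p j}" and line_subset: "span {p j} \<subseteq> A"
      using member \<open>x \<in> A\<close> by (auto simp: other_lines_def)
    have "closed_segment 0 x \<subseteq> span {p j}"
      using in_line by (intro closed_segment_subset) (simp_all add: span_zero subspace_imp_convex)
    then show ?thesis
      using line_subset by blast
  qed
qed

lemma caratheodory_number_other_lines:
  assumes "finite I"
    and "\<And>i j. i \<in> I \<Longrightarrow> j \<in> I \<Longrightarrow> i \<noteq> j \<Longrightarrow> p i \<notin> span {p j}"
    and "\<And>i. i \<in> I \<Longrightarrow> x \<notin> span {p i}"
  shows "caratheodory_number (other_lines p I ` I) = enat (card I)"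
proof (rule caratheodory_number_eq_card)
  show "p j \<in> other_lines p I i \<longleftrightarrow> j \<noteq> i" if "i \<in> I" "j \<in> I" for i j
    using assms(2) that by (auto simp: other_lines_def intro: span_base)
qed (use assms(1,3) in \<open>auto simp: other_lines_def\<close>)

lemma ex_not_in_span_singleton:
  fixes v :: "'a::euclidean_space"
  assumes "DIM('a) \<ge> 2"
  shows "\<exists>u. u \<notin> span {v}"
proof (rule ccontr)
  assume "\<not> (\<exists>u. u \<notin> span {v})"
  then have "span {v} = UNIV"
    by blast
  then have "DIM('a) = dim {v}"
    by (metis dim_UNIV dim_span)
  then show False
    using assms by (simp split: if_splits)
qed

lemma scaleR_eq_imp_0_not_in_span:
  fixes u v :: "'a::real_vector"
  assumes "u \<notin> span {v}" and "v \<noteq> 0" and "a *\<^sub>R u = b *\<^sub>R v"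
  shows "a = 0" and "b = 0"
proof -
  show "a = 0"
  proof (rule ccontr)
    assume "a \<noteq> 0"
    then have "u = (b / a) *\<^sub>R v"
      using assms(3) by (metis divide_inverse_commute scaleR_scaleR scaleR_one left_inverse)
    then show False
      using assms(1) by (auto simp: span_singleton)
  qed
  then show "b = 0"
    using assms(2,3) by simp
qed

lemma add_scaleR_in_span_iff:
  fixes u v :: "'a::real_vector"
  assumes "u \<notin> span {v}" and "v \<noteq> 0"
  shows "u + s *\<^sub>R v \<in> span {u + t *\<^sub>R v} \<longleftrightarrow> s = t"
proof
  assume "u + s *\<^sub>R v \<in> span {u + t *\<^sub>R v}"
  then obtain k where "u + s *\<^sub>R v = k *\<^sub>R (u + t *\<^sub>R v)"
    by (auto simp: span_singleton)
  then have "(1 - k) *\<^sub>R u = (k * t - s) *\<^sub>R v"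
    by (simp add: algebra_simps)
  then have "1 - k = 0" "k * t - s = 0"
    by (rule scaleR_eq_imp_0_not_in_span[OF assms])+
  then show "s = t"
    by simp
qed (simp add: span_base)

lemma not_in_span_add_scaleR:
  fixes u v :: "'a::real_vector"
  assumes "u \<notin> span {v}" and "v \<noteq> 0"
  shows "v \<notin> span {u + t *\<^sub>R v}"
proof
  assume "v \<in> span {u + t *\<^sub>R v}"
  then obtain k where "v = k *\<^sub>R (u + t *\<^sub>R v)"
    by (auto simp: span_singleton)
  then have "k *\<^sub>R u = (1 - k * t) *\<^sub>R v"
    by (simp add: algebra_simps)
  then have "k = 0" "1 - k * t = 0"
    by (rule scaleR_eq_imp_0_not_in_span[OF assms])+
  then show False
    by simp
qed

theorem theorem7:
  fixes c :: nat
  assumes "c \<ge> 2" and "CARD('d::finite) \<ge> 2"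
  shows "\<exists>F :: (real ^ 'd) set set.
           finite F \<and> TC_infinity F = 0 \<and> caratheodory_number F = enat c"
proof -
  obtain v :: "real ^ 'd" where "v \<noteq> 0"
    using nonzero_Basis SOME_Basis by blast
  obtain u where "u \<notin> span {v}"
    using ex_not_in_span_singleton[of v] assms(2) by auto
  define p where "p j = u + real j *\<^sub>R v" for j
  let ?F = "other_lines p {..<c} ` {..<c}"
  have "caratheodory_number ?F = enat (card {..<c})"
  proof (rule caratheodory_number_other_lines)
    show "p i \<notin> span {p j}" if "i \<noteq> j" for i j
      using that add_scaleR_in_span_iff[OF \<open>u \<notin> span {v}\<close> \<open>v \<noteq> 0\<close>] by (simp add: p_def)
    show "v \<notin> span {p i}" for i
      using not_in_span_add_scaleR[OF \<open>u \<notin> span {v}\<close> \<open>v \<noteq> 0\<close>] by (simp add: p_def)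
  qed simp
  moreover have "TC_infinity ?F = 0"
  proof (rule TC_infinity_other_lines)
    have "card {..<c} \<noteq> card {i}" for i
      using assms(1) by simp
    then show "{..<c} \<noteq> {i}" for i
      by metis
  qed
  ultimately show ?thesis
    by (intro exI[of _ ?F]) simp
qed

end
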